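(* Let $k\in\mathbb{N}$ and let $T=(V(T),E(T);f,g)$ be a weighted tree on $n\ge 2$ vertices, with vertex-weight function $f(w)=(f(w)_0,f(w)_1,\dots,f(w)_k)\in \mathcal{R}^{k+1}$ for $w\in V(T)$ and edge-weight function $g:E(T)\to\mathcal{R}$, where $\mathcal{R}$ is a commutative ring with unit element $1$. Let $u$ be a leaf of $T$ and let $p_u=(u,v)$ be the pendant edge at $u$. Let $T'=(V(T'),E(T');f',g')$ be the weighted tree with $V(T')=V(T)\setminus\{u\}$, $E(T')=E(T)\setminus\{p_u\}$, $g'(e)=g(e)$ for all $e\in E(T')$, and, for $i=0,1,\dots,k$ and $w\in V(T')$, $$f'(w)_i=\begin{cases} f(v)_i+f(v)_{i-1}\,g(p_u)\sum_{j=0}^{k-1}f(u)_j & \text{if } w=v,\\ f(w)_i & \text{otherwise.}\end{cases}$$ Then $$F_{\le k}(T;f,g)=F_{\le k}(T';f',g')+\sum_{j=0}^{k}f(u)_j .$$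
   Context: Conventions: $f(w)_i=0$ for every integer $i<0$; empty sums equal $0$ and empty products equal $1$. A subtree of a tree $T$ is a non-empty connected subgraph of $T$ (a single vertex is allowed). $\mathcal{S}_{\le k}(T)$ is the set of all subtrees $T_s$ of $T$ with maximum degree $\le k$, i.e. $\deg_{T_s}(w)\le k$ for all $w\in V(T_s)$, where $\deg_{T_s}(w)$ is the degree of $w$ inside $T_s$. For $T_s\in\mathcal{S}_{\le k}(T)$, its max $k$ degree subtree weight is $$\omega_k(T_s)=\prod_{w\in V(T_s)}\Big(\sum_{i=0}^{k-\deg_{T_s}(w)}f(w)_i\Big)\prod_{e\in E(T_s)}g(e),$$ and the max $k$ degree subtree generating function of $T$ is $F_{\le k}(T;f,g)=\sum_{T_s\in\mathcal{S}_{\le k}(T)}\omega_k(T_s)$. For $T'$ the same definitions are used with $f',g'$. *)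

theory Defs
  imports Main
begin

text \<open>
  A finite simple undirected graph is given by its vertex set and its edge set, an edge being
  the two-element set of its ends.  The directed graphs of AFP Graph Theory are not used:
  their notion of forest excludes directed cycles only, and in a symmetric digraph every edge
  is already a directed cycle of length two.
\<close>

type_synonym 'a graph = "'a set \<times> 'a set set"

abbreviation verts :: "'a graph \<Rightarrow> 'a set" where "verts \<equiv> fst"
abbreviation edges :: "'a graph \<Rightarrow> 'a set set" where "edges \<equiv> snd"

definition simple_graph :: "'a graph \<Rightarrow> bool" where
  "simple_graph G \<longleftrightarrow>
     finite (verts G) \<and> (\<forall>e\<in>edges G. \<exists>x\<in>verts G. \<exists>y\<in>verts G. x \<noteq> y \<and> e = {x, y})"

definition adj :: "'a graph \<Rightarrow> ('a \<times> 'a) set" where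
  "adj G = {(x, y). {x, y} \<in> edges G}"

definition connected_graph :: "'a graph \<Rightarrow> bool" where
  "connected_graph G \<longleftrightarrow> (\<forall>x\<in>verts G. \<forall>y\<in>verts G. (x, y) \<in> (adj G)\<^sup>*)"

definition cycle :: "'a graph \<Rightarrow> 'a list \<Rightarrow> bool" where
  "cycle G xs \<longleftrightarrow> 3 \<le> length xs \<and> distinct xs \<and>
     (\<forall>i<length xs. {xs ! i, xs ! (Suc i mod length xs)} \<in> edges G)"

definition tree :: "'a graph \<Rightarrow> bool" where
  "tree G \<longleftrightarrow> simple_graph G \<and> verts G \<noteq> {} \<and> connected_graph G \<and> (\<nexists>xs. cycle G xs)"

definition degree :: "'a graph \<Rightarrow> 'a \<Rightarrow> nat" where
  "degree G w = card {e \<in> edges G. w \<in> e}"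

definition leaf :: "'a graph \<Rightarrow> 'a \<Rightarrow> bool" where
  "leaf G u \<longleftrightarrow> u \<in> verts G \<and> degree G u = 1"

definition subgraph :: "'a graph \<Rightarrow> 'a graph \<Rightarrow> bool" where
  "subgraph H G \<longleftrightarrow> simple_graph H \<and> verts H \<subseteq> verts G \<and> edges H \<subseteq> edges G"

definition subtree :: "'a graph \<Rightarrow> 'a graph \<Rightarrow> bool" where
  "subtree S T \<longleftrightarrow> subgraph S T \<and> verts S \<noteq> {} \<and> connected_graph S"

definition subtrees_le :: "nat \<Rightarrow> 'a graph \<Rightarrow> 'a graph set" where
  "subtrees_le k T = {S. subtree S T \<and> (\<forall>w\<in>verts S. degree S w \<le> k)}"

text \<open>
  A vertex weight in \<open>R\<^sup>k\<^sup>+\<^sup>1\<close> is a function on \<open>nat\<close> of which only the values at \<open>0, \<dots>, k\<close>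
  are used.  The sort \<open>{comm_ring, comm_monoid_mult}\<close> is that of commutative rings with unit;
  unlike \<open>comm_ring_1\<close> it does not demand \<open>0 \<noteq> 1\<close>.
\<close>

definition subtree_weight ::
  "nat \<Rightarrow> ('a \<Rightarrow> nat \<Rightarrow> 'r) \<Rightarrow> ('a set \<Rightarrow> 'r) \<Rightarrow> 'a graph \<Rightarrow> 'r::{comm_ring, comm_monoid_mult}" where
  "subtree_weight k f g S =
     (\<Prod>w\<in>verts S. \<Sum>i=0..k - degree S w. f w i) * (\<Prod>e\<in>edges S. g e)"

definition subtree_gf ::
  "nat \<Rightarrow> 'a graph \<Rightarrow> ('a \<Rightarrow> nat \<Rightarrow> 'r) \<Rightarrow> ('a set \<Rightarrow> 'r) \<Rightarrow> 'r::{comm_ring, comm_monoid_mult}" where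
  "subtree_gf k T f g = (\<Sum>S\<in>subtrees_le k T. subtree_weight k f g S)"

text \<open>Components of a vertex weight at integer indices, zero at negative ones.\<close>

definition component :: "(nat \<Rightarrow> 'r::zero) \<Rightarrow> int \<Rightarrow> 'r" where
  "component a i = (if i < 0 then 0 else a (nat i))"

end

theory Submission
  imports Defs
begin

text \<open>
  Sort the subtrees of \<open>T\<close> by how they meet the leaf \<open>u\<close>.  Those avoiding \<open>u\<close> are the subtrees of
  \<open>T'\<close>; one of them is the single vertex \<open>u\<close>; every other one contains the pendant edge, because
  that edge is the only way to leave \<open>u\<close>, and it arises from exactly one subtree \<open>S\<close> of \<open>T'\<close> through
  \<open>v\<close> by attaching \<open>u\<close>.  Attaching raises the degree of \<open>v\<close> by one, so the result respects the bound
  \<open>k\<close> precisely when \<open>v\<close> has degree less than \<open>k\<close> in \<open>S\<close>.  This is the decomposition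
  \<open>subtrees_le_pendant\<close>.

  The single vertex \<open>u\<close> accounts for the extra summand of the theorem.  The modified weight at \<open>v\<close>
  is designed so that the weight of \<open>S\<close> with respect to \<open>f'\<close> and \<open>g'\<close> collects the old weights of
  \<open>S\<close> and of \<open>S\<close> with \<open>u\<close> attached (\<open>subtree_weight_pendant\<close>): with \<open>d\<close> the degree of \<open>v\<close> in \<open>S\<close>, the
  index shift in the second part of the new weight turns the range \<open>0, \<dots>, k - d\<close> into
  \<open>0, \<dots>, k - (d + 1)\<close>, the range belonging to degree \<open>d + 1\<close>, and the factor
  \<open>g {u, v} * (\<Sum>j<k. f u j)\<close> is what the new edge and the new vertex, of degree one, contribute.
  Nothing is left of the second part when \<open>d = k\<close>, which is when attaching is forbidden.
\<close>

section \<open>Attaching and detaching a pendant vertex\<close>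

definition attach :: "'a \<Rightarrow> 'a \<Rightarrow> 'a graph \<Rightarrow> 'a graph" where
  "attach u v S = (insert u (verts S), insert {u, v} (edges S))"

definition detach :: "'a \<Rightarrow> 'a \<Rightarrow> 'a graph \<Rightarrow> 'a graph" where
  "detach u v S = (verts S - {u}, edges S - {{u, v}})"

lemma verts_attach [simp]: "verts (attach u v S) = insert u (verts S)"
  and edges_attach [simp]: "edges (attach u v S) = insert {u, v} (edges S)"
  and verts_detach [simp]: "verts (detach u v S) = verts S - {u}"
  and edges_detach [simp]: "edges (detach u v S) = edges S - {{u, v}}"
  by (simp_all add: attach_def detach_def)

lemma attach_detach:
  assumes "u \<in> verts S" "{u, v} \<in> edges S"
  shows "attach u v (detach u v S) = S"
  using assms by (intro prod_eqI) auto

lemma detach_attach: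
  assumes "u \<notin> verts S" "{u, v} \<notin> edges S"
  shows "detach u v (attach u v S) = S"
  using assms by (intro prod_eqI) auto

lemma simple_graph_edge_subset:
  assumes "simple_graph G" "e \<in> edges G"
  shows "e \<subseteq> verts G"
  using assms by (auto simp: simple_graph_def)

lemma simple_graph_edge_neq:
  assumes "simple_graph G" "{x, y} \<in> edges G"
  shows "x \<noteq> y"
  using assms unfolding simple_graph_def by (metis doubleton_eq_iff)

lemma simple_graph_finite:
  assumes "simple_graph G"
  shows "finite (verts G)" "finite (edges G)"
proof -
  show fin: "finite (verts G)"
    using assms by (simp add: simple_graph_def)
  have "edges G \<subseteq> Pow (verts G)"
    using simple_graph_edge_subset[OF assms] by blast
  then show "finite (edges G)"
    using fin by (meson finite_Pow_iff finite_subset)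
qed

lemma finite_subtrees_le:
  assumes "simple_graph T"
  shows "finite (subtrees_le k T)"
proof (rule finite_subset)
  show "subtrees_le k T \<subseteq> Pow (verts T) \<times> Pow (edges T)"
    by (auto simp: subtrees_le_def subtree_def subgraph_def)
  show "finite (Pow (verts T) \<times> Pow (edges T))"
    using simple_graph_finite[OF assms] by simp
qed

lemma leaf_edge_unique:
  assumes "leaf T u" "{u, v} \<in> edges T" "e \<in> edges T" "u \<in> e"
  shows "e = {u, v}"
proof -
  obtain a where a: "{e \<in> edges T. u \<in> e} = {a}"
    using assms(1) by (auto simp: leaf_def degree_def card_1_singleton_iff)
  have "e \<in> {e \<in> edges T. u \<in> e}" "{u, v} \<in> {e \<in> edges T. u \<in> e}"
    using assms by auto
  then show ?thesis
    unfolding a by simp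
qed

lemma simple_graph_attach:
  assumes "simple_graph S" "u \<notin> verts S" "v \<in> verts S"
  shows "simple_graph (attach u v S)"
  unfolding simple_graph_def
proof (intro conjI ballI)
  show "finite (verts (attach u v S))"
    using simple_graph_finite(1)[OF assms(1)] by simp
  fix e assume "e \<in> edges (attach u v S)"
  then consider "e = {u, v}" | "e \<in> edges S"
    by auto
  then show "\<exists>x\<in>verts (attach u v S). \<exists>y\<in>verts (attach u v S). x \<noteq> y \<and> e = {x, y}"
  proof cases
    case 1
    moreover have "u \<noteq> v"
      using assms(2,3) by blast
    ultimately show ?thesis
      using assms(3) by (intro bexI[of _ u] bexI[of _ v]) simp_all
  next
    case 2
    then obtain x y where "x \<in> verts S" "y \<in> verts S" "x \<noteq> y" "e = {x, y}"
      using assms(1) unfolding simple_graph_def by blast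
    then show ?thesis
      by (intro bexI[of _ x] bexI[of _ y]) simp_all
  qed
qed

lemma simple_graph_detach:
  assumes "simple_graph S" "\<And>e. e \<in> edges S \<Longrightarrow> u \<in> e \<Longrightarrow> e = {u, v}"
  shows "simple_graph (detach u v S)"
  unfolding simple_graph_def
proof (intro conjI ballI)
  show "finite (verts (detach u v S))"
    using simple_graph_finite(1)[OF assms(1)] by simp
  fix e assume "e \<in> edges (detach u v S)"
  then have e: "e \<in> edges S" "e \<noteq> {u, v}"
    by simp_all
  then have "u \<notin> e"
    using assms(2) by blast
  moreover obtain x y where "x \<in> verts S" "y \<in> verts S" "x \<noteq> y" "e = {x, y}"
    using assms(1) e(1) unfolding simple_graph_def by blast
  ultimately show "\<exists>x\<in>verts (detach u v S). \<exists>y\<in>verts (detach u v S). x \<noteq> y \<and> e = {x, y}"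
    by (intro bexI[of _ x] bexI[of _ y]) auto
qed

lemma degree_attach:
  assumes "simple_graph S" "u \<notin> verts S" "v \<in> verts S"
  shows "degree (attach u v S) w =
    (if w = u then 1 else if w = v then Suc (degree S v) else degree S w)"
proof -
  have no_u: "u \<notin> e" if "e \<in> edges S" for e
    using simple_graph_edge_subset[OF assms(1) that] assms(2) by blast
  have fin: "finite {e \<in> edges S. w \<in> e}"
    using simple_graph_finite(2)[OF assms(1)] by simp
  have new: "{u, v} \<notin> {e \<in> edges S. w \<in> e}"
    using no_u by blast
  show ?thesis
  proof (cases "w = u \<or> w = v")
    case True
    then have "{e \<in> edges (attach u v S). w \<in> e} = insert {u, v} {e \<in> edges S. w \<in> e}"
      by auto
    then have Suc_deg: "degree (attach u v S) w = Suc (degree S w)"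
      unfolding degree_def using card_insert_disjoint[OF fin new] by (simp only:)
    have no_edge: "{e \<in> edges S. u \<in> e} = {}"
      using no_u by blast
    have "degree S u = 0"
      unfolding degree_def no_edge by simp
    then show ?thesis
      using True Suc_deg by (metis One_nat_def)
  next
    case False
    then have "{e \<in> edges (attach u v S). w \<in> e} = {e \<in> edges S. w \<in> e}"
      by auto
    then show ?thesis
      using False unfolding degree_def by simp
  qed
qed

lemma connected_graph_attach:
  assumes "connected_graph S" "v \<in> verts S"
  shows "connected_graph (attach u v S)"
proof -
  let ?R = "(adj (attach u v S))\<^sup>*"
  have sub: "(adj S)\<^sup>* \<subseteq> ?R"
    by (rule rtrancl_mono) (auto simp: adj_def)
  have uv: "(u, v) \<in> ?R" "(v, u) \<in> ?R"
    by (auto simp: adj_def insert_commute)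
  have "(x, v) \<in> ?R \<and> (v, x) \<in> ?R" if "x \<in> verts (attach u v S)" for x
    using that assms sub uv unfolding connected_graph_def by auto
  then show ?thesis
    unfolding connected_graph_def by (meson rtrancl_trans)
qed

text \<open>
  A walk that enters \<open>u\<close> must return to \<open>v\<close> at once.  The walk can therefore be shortcut by replacing
  each visit to \<open>u\<close> with a stay at \<open>v\<close>.
\<close>

lemma connected_graph_detach:
  assumes "connected_graph S" "\<And>e. e \<in> edges S \<Longrightarrow> u \<in> e \<Longrightarrow> e = {u, v}"
  shows "connected_graph (detach u v S)"
  unfolding connected_graph_def
proof (intro ballI)
  fix x y
  assume "x \<in> verts (detach u v S)" "y \<in> verts (detach u v S)"
  then have x: "x \<in> verts S" "x \<noteq> u" and y: "y \<in> verts S" "y \<noteq> u"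
    by auto
  have "(x, y) \<in> (adj S)\<^sup>*"
    using assms(1) x y by (simp add: connected_graph_def)
  then have "(x, if y = u then v else y) \<in> (adj (detach u v S))\<^sup>*"
  proof induction
    case base
    show ?case using x by simp
  next
    case (step y z)
    have yz: "{y, z} \<in> edges S"
      using step.hyps by (simp add: adj_def)
    show ?case
    proof (cases "y = u \<or> z = u")
      case True
      then have "{y, z} = {u, v}"
        using assms(2)[OF yz] by auto
      then have "(if y = u then v else y) = (if z = u then v else z)"
        by (auto simp: doubleton_eq_iff)
      then show ?thesis
        using step.IH by simp
    next
      case False
      then have "(y, z) \<in> adj (detach u v S)"
        using yz by (auto simp: adj_def doubleton_eq_iff)
      then show ?thesis
        using False step.IH by (auto intro: rtrancl_into_rtrancl)
    qed
  qed
  then show "(x, y) \<in> (adj (detach u v S))\<^sup>*"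
    using y by simp
qed

section \<open>Subtrees and a pendant edge\<close>

lemma subtree_detach_iff:
  shows "subtree S (detach u v T) \<longleftrightarrow> subtree S T \<and> u \<notin> verts S"
proof -
  have "{u, v} \<notin> edges S" if "simple_graph S" "u \<notin> verts S"
    using simple_graph_edge_subset[OF that(1)] that(2) by blast
  then show ?thesis
    unfolding subtree_def subgraph_def verts_detach edges_detach by blast
qed

text \<open>
  A subtree with a further vertex contains a walk from \<open>u\<close> to it, and the first step of that walk
  can only use the pendant edge.
\<close>

lemma subtree_pendant_edge:
  assumes "leaf T u" "{u, v} \<in> edges T" "subtree S T" "u \<in> verts S" "verts S \<noteq> {u}"
  shows "{u, v} \<in> edges S"
proof -
  obtain x where x: "x \<in> verts S" "x \<noteq> u"
    using assms(4,5) by blast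
  have "(u, x) \<in> (adj S)\<^sup>*"
    using assms(3,4) x(1) by (simp add: subtree_def connected_graph_def)
  then obtain y where y: "{u, y} \<in> edges S"
    using x(2) by (auto elim: converse_rtranclE simp: adj_def)
  then have "{u, y} \<in> edges T"
    using assms(3) by (auto simp: subtree_def subgraph_def)
  then have "{u, y} = {u, v}"
    using leaf_edge_unique[OF assms(1,2)] by blast
  then show ?thesis
    using y by simp
qed

lemma subtrees_le_singleton:
  assumes "u \<in> verts T"
  shows "({u}, {}) \<in> subtrees_le k T"
  using assms
  by (simp add: subtrees_le_def subtree_def subgraph_def simple_graph_def connected_graph_def
      degree_def)

lemma attach_in_subtrees_le:
  assumes "u \<in> verts T" "{u, v} \<in> edges T"
    and "S \<in> subtrees_le k T" "u \<notin> verts S" "v \<in> verts S" "degree S v < k"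
  shows "attach u v S \<in> subtrees_le k T"
proof -
  have S: "simple_graph S" "connected_graph S" "verts S \<subseteq> verts T" "edges S \<subseteq> edges T"
    and deg: "\<And>w. w \<in> verts S \<Longrightarrow> degree S w \<le> k"
    using assms(3) by (auto simp: subtrees_le_def subtree_def subgraph_def)
  have "subtree (attach u v S) T"
    using S assms(1,2) simple_graph_attach[OF S(1) assms(4,5)]
      connected_graph_attach[OF S(2) assms(5)]
    by (auto simp: subtree_def subgraph_def)
  moreover have "degree (attach u v S) w \<le> k" if "w \<in> verts (attach u v S)" for w
    using that deg assms(6) by (auto simp: degree_attach[OF S(1) assms(4,5)])
  ultimately show ?thesis
    by (simp add: subtrees_le_def)
qed

text \<open>
  Since \<open>S\<close> is \<open>detach u v S\<close> with \<open>u\<close> attached again, \<open>degree_attach\<close> compares the degrees of the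
  two: removing the leaf lowers the degree of \<open>v\<close> by one, which leaves room below \<open>k\<close>.
\<close>

lemma detach_in_subtrees_le:
  assumes "leaf T u" "{u, v} \<in> edges T"
    and "S \<in> subtrees_le k T" "{u, v} \<in> edges S"
  shows "detach u v S \<in> subtrees_le k T"
    and "v \<in> verts (detach u v S)"
    and "degree (detach u v S) v < k"
proof -
  let ?D = "detach u v S"
  have S: "simple_graph S" "connected_graph S" "verts S \<subseteq> verts T" "edges S \<subseteq> edges T"
    and deg: "\<And>w. w \<in> verts S \<Longrightarrow> degree S w \<le> k"
    using assms(3) by (auto simp: subtrees_le_def subtree_def subgraph_def)
  have only: "e = {u, v}" if "e \<in> edges S" "u \<in> e" for e
    using leaf_edge_unique[OF assms(1,2)] that S(4) by blast
  have uv: "u \<in> verts S" "v \<in> verts S" "u \<noteq> v"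
    using simple_graph_edge_subset[OF S(1) assms(4)] simple_graph_edge_neq[OF S(1) assms(4)]
    by auto
  then show v: "v \<in> verts ?D"
    by simp
  have simp_D: "simple_graph ?D"
    using simple_graph_detach[OF S(1) only] .
  have deg_D: "degree S w =
    (if w = u then 1 else if w = v then Suc (degree ?D v) else degree ?D w)" for w
    using degree_attach[OF simp_D _ v, of u w] by (simp add: attach_detach[OF uv(1) assms(4)])
  show "degree ?D v < k"
    using deg[OF uv(2)] deg_D[of v] uv(3) by simp
  have "degree ?D w \<le> k" if "w \<in> verts ?D" for w
    using that deg[of w] deg_D[of w] by (auto split: if_splits)
  moreover have "subtree ?D T"
    using v S simp_D connected_graph_detach[OF S(2) only]
    unfolding subtree_def subgraph_def by auto
  ultimately show "?D \<in> subtrees_le k T"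
    by (simp add: subtrees_le_def)
qed

text \<open>
  The three parts correspond to subtrees with \<open>u\<close> as only vertex, subtrees avoiding \<open>u\<close>, and
  subtrees containing \<open>u\<close> together with another vertex; \<open>subtree_pendant_edge\<close> lets the last kind
  be obtained by attaching \<open>u\<close> to what remains after detaching it.
\<close>

lemma subtrees_le_pendant:
  assumes "simple_graph T" "leaf T u" "{u, v} \<in> edges T"
  shows "subtrees_le k T =
    insert ({u}, {}) (subtrees_le k (detach u v T) \<union>
      attach u v ` {S \<in> subtrees_le k (detach u v T). v \<in> verts S \<and> degree S v < k})"
    (is "?L = insert ?s (?A \<union> attach u v ` ?B)")
proof
  have u: "u \<in> verts T"
    using assms(2) by (simp add: leaf_def)
  have A_iff: "S \<in> ?A \<longleftrightarrow> S \<in> ?L \<and> u \<notin> verts S" for S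
    using subtree_detach_iff[of S u v T] by (auto simp: subtrees_le_def)
  show "?L \<subseteq> insert ?s (?A \<union> attach u v ` ?B)"
  proof
    fix S assume S: "S \<in> ?L"
    then have st: "subtree S T" and simp_S: "simple_graph S"
      by (auto simp: subtrees_le_def subtree_def subgraph_def)
    consider "u \<notin> verts S" | "verts S = {u}" | "u \<in> verts S" "verts S \<noteq> {u}"
      by blast
    then show "S \<in> insert ?s (?A \<union> attach u v ` ?B)"
    proof cases
      case 1
      then show ?thesis using S A_iff by simp
    next
      case 2
      then have "edges S = {}"
        using simp_S by (auto simp: simple_graph_def)
      then have "S = ?s"
        using 2 by (intro prod_eqI) auto
      then show ?thesis by simp
    next
      case 3
      have uv: "{u, v} \<in> edges S"
        by (rule subtree_pendant_edge[OF assms(2,3) st 3])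
      have "detach u v S \<in> ?B"
        using detach_in_subtrees_le[OF assms(2,3) S uv] A_iff by simp
      moreover have "S = attach u v (detach u v S)"
        using attach_detach[OF 3(1) uv] by simp
      ultimately show ?thesis by blast
    qed
  qed
  show "insert ?s (?A \<union> attach u v ` ?B) \<subseteq> ?L"
    using A_iff subtrees_le_singleton[OF u] attach_in_subtrees_le[OF u assms(3)] by auto
qed

section \<open>Weights\<close>

text \<open>
  Isolating the factor of \<open>v\<close> leaves a product that is the same for \<open>S\<close>, for \<open>S\<close> with a vertex
  attached at \<open>v\<close>, and for the modified weights.  The next two lemmas display this common product,
  so that only factors at \<open>v\<close> and at the new vertex and edge have to be compared.
\<close>

lemma subtree_weight_split:
  fixes f :: "'a \<Rightarrow> nat \<Rightarrow> 'r::{comm_ring, comm_monoid_mult}"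
  assumes "simple_graph S" "v \<in> verts S"
  shows "subtree_weight k f g S =
    (\<Sum>i=0..k - degree S v. f v i) *
    ((\<Prod>w\<in>verts S - {v}. \<Sum>i=0..k - degree S w. f w i) * (\<Prod>e\<in>edges S. g e))"
  unfolding subtree_weight_def
  by (simp add: prod.remove[OF simple_graph_finite(1)[OF assms(1)] assms(2)] mult.assoc)

lemma subtree_weight_attach:
  fixes f :: "'a \<Rightarrow> nat \<Rightarrow> 'r::{comm_ring, comm_monoid_mult}"
  assumes "simple_graph S" "u \<notin> verts S" "v \<in> verts S"
  shows "subtree_weight k f g (attach u v S) =
    (\<Sum>i=0..k - Suc (degree S v). f v i) * g {u, v} * (\<Sum>j=0..k - 1. f u j) *
    ((\<Prod>w\<in>verts S - {v}. \<Sum>i=0..k - degree S w. f w i) * (\<Prod>e\<in>edges S. g e))"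
proof -
  have fin: "finite (verts S)" "finite (edges S)"
    using simple_graph_finite[OF assms(1)] by auto
  have new: "{u, v} \<notin> edges S"
    using simple_graph_edge_subset[OF assms(1)] assms(2) by blast
  have uv: "u \<noteq> v"
    using assms(2,3) by blast
  note deg = degree_attach[OF assms]
  have "(\<Prod>w\<in>verts S. \<Sum>i=0..k - degree (attach u v S) w. f w i) =
    (\<Sum>i=0..k - Suc (degree S v). f v i) *
    (\<Prod>w\<in>verts S - {v}. \<Sum>i=0..k - degree (attach u v S) w. f w i)"
    using uv by (simp add: prod.remove[OF fin(1) assms(3)] deg)
  also have "(\<Prod>w\<in>verts S - {v}. \<Sum>i=0..k - degree (attach u v S) w. f w i) =
    (\<Prod>w\<in>verts S - {v}. \<Sum>i=0..k - degree S w. f w i)"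
    using assms(2) by (intro prod.cong) (auto simp: deg)
  finally show ?thesis
    using fin new assms(2) unfolding subtree_weight_def by (simp add: deg mult_ac)
qed

text \<open>
  The index shift by one loses the top term of the range, so the shifted sum runs over \<open>m\<close>
  components only; for \<open>m = 0\<close> it is empty.
\<close>

lemma sum_component_shift:
  fixes a :: "nat \<Rightarrow> 'r::comm_ring"
  shows "(\<Sum>i=0..m. component a (int i) + component a (int i - 1) * c * d) =
    (\<Sum>i=0..m. a i) + (\<Sum>i<m. a i) * c * d"
proof -
  have "(\<Sum>i=0..m. component a (int i - 1)) = (\<Sum>i<m. a i)"
    by (induction m) (simp_all add: component_def)
  then show ?thesis
    by (simp add: sum.distrib flip: sum_distrib_right) (simp add: component_def)
qed

text \<open>
  Passing to the modified weights accounts for attaching \<open>u\<close>: expanding the sum at \<open>v\<close> by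
  \<open>sum_component_shift\<close> yields two parts, which multiplied by the common product are the old weights
  of \<open>S\<close> and of \<open>attach u v S\<close>.
\<close>

lemma subtree_weight_pendant:
  fixes f f' :: "'a \<Rightarrow> nat \<Rightarrow> 'r::{comm_ring, comm_monoid_mult}"
  assumes "simple_graph S" "u \<notin> verts S" "v \<in> verts S \<Longrightarrow> degree S v \<le> k"
    and g': "\<And>e. e \<in> edges S \<Longrightarrow> g' e = g e"
    and f': "\<And>w i. w \<in> verts S \<Longrightarrow> i \<le> k \<Longrightarrow>
           f' w i =
             (if w = v
              then component (f v) (int i)
                   + component (f v) (int i - 1) * g {u, v} * (\<Sum>j<k. f u j)
              else f w i)"
  shows "subtree_weight k f' g' S = subtree_weight k f g S +
    (if v \<in> verts S \<and> degree S v < k then subtree_weight k f g (attach u v S) else 0)"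
proof (cases "v \<in> verts S")
  case False
  then have "subtree_weight k f' g' S = subtree_weight k f g S"
    using f' g' unfolding subtree_weight_def
    by (intro arg_cong2[where f = "(*)"] prod.cong sum.cong) auto
  then show ?thesis
    using False by simp
next
  case True
  define d where "d = degree S v"
  define P where
    "P = (\<Prod>w\<in>verts S - {v}. \<Sum>i=0..k - degree S w. f w i) * (\<Prod>e\<in>edges S. g e)"
  have P': "(\<Prod>w\<in>verts S - {v}. \<Sum>i=0..k - degree S w. f' w i) * (\<Prod>e\<in>edges S. g' e) = P"
    using f' g' unfolding P_def
    by (intro arg_cong2[where f = "(*)"] prod.cong sum.cong) auto
  have "(\<Sum>i=0..k - d. f' v i) =
    (\<Sum>i=0..k - d. component (f v) (int i)
      + component (f v) (int i - 1) * g {u, v} * (\<Sum>j<k. f u j))"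
    using f' True by (intro sum.cong) auto
  then have w': "subtree_weight k f' g' S =
    ((\<Sum>i=0..k - d. f v i) + (\<Sum>i<k - d. f v i) * g {u, v} * (\<Sum>j<k. f u j)) * P"
    using subtree_weight_split[OF assms(1) True, of k f' g'] P'
    by (simp add: d_def sum_component_shift)
  have w: "subtree_weight k f g S = (\<Sum>i=0..k - d. f v i) * P"
    using subtree_weight_split[OF assms(1) True, of k f g] by (simp add: d_def P_def)
  show ?thesis
  proof (cases "d < k")
    case less: True
    \<comment> \<open>Both equations rest on \<open>d < k\<close>: with truncated subtraction the closed intervals are never empty.\<close>
    have "{0..k - Suc d} = {..<k - d}" "{0..k - 1} = {..<k}"
      using less by auto
    then have "subtree_weight k f g (attach u v S) =
      (\<Sum>i<k - d. f v i) * g {u, v} * (\<Sum>j<k. f u j) * P"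
      using subtree_weight_attach[OF assms(1,2) True, of k f g] by (simp add: d_def P_def)
    then show ?thesis
      using w w' True less by (simp add: d_def distrib_right)
  next
    case False
    \<comment> \<open>The degree bound forces \<open>d = k\<close>, so the shifted part of the sum at \<open>v\<close> is empty.\<close>
    then have "k - d = 0"
      using assms(3)[OF True] by (simp add: d_def)
    then show ?thesis
      using w w' False by (simp add: d_def)
  qed
qed

lemma subtree_weight_singleton:
  fixes f :: "'a \<Rightarrow> nat \<Rightarrow> 'r::{comm_ring, comm_monoid_mult}"
  shows "subtree_weight k f g ({u}, {}) = (\<Sum>j=0..k. f u j)"
  by (simp add: subtree_weight_def degree_def)

section \<open>The generating function\<close>

theorem theorem3p1:
  fixes k :: nat
    and T T' :: "'a graph"
    and f f' :: "'a \<Rightarrow> nat \<Rightarrow> 'r::{comm_ring, comm_monoid_mult}"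
    and g g' :: "'a set \<Rightarrow> 'r"
    and u v :: 'a
  assumes "tree T"
    and "card (verts T) \<ge> 2"
    and "leaf T u"
    and "{u, v} \<in> edges T"
    and "verts T' = verts T - {u}"
    and "edges T' = edges T - {{u, v}}"
    and "\<And>e. e \<in> edges T' \<Longrightarrow> g' e = g e"
    and "\<And>w i. w \<in> verts T' \<Longrightarrow> i \<le> k \<Longrightarrow>
           f' w i =
             (if w = v
              then component (f v) (int i)
                   + component (f v) (int i - 1) * g {u, v} * (\<Sum>j<k. f u j)
              else f w i)"
  shows "subtree_gf k T f g = subtree_gf k T' f' g' + (\<Sum>j=0..k. f u j)"
proof -
  have simp_T: "simple_graph T"
    using assms(1) by (simp add: tree_def)
  have T': "T' = detach u v T"
    using assms(5,6) by (intro prod_eqI) auto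
  let ?A = "subtrees_le k T'"
  let ?B = "{S \<in> ?A. v \<in> verts S \<and> degree S v < k}"
  have A: "simple_graph S" "u \<notin> verts S" "verts S \<subseteq> verts T'" "edges S \<subseteq> edges T'"
    "v \<in> verts S \<Longrightarrow> degree S v \<le> k" if "S \<in> ?A" for S
    using that assms(5) by (auto simp: subtrees_le_def subtree_def subgraph_def)
  have simp_T': "simple_graph T'"
    using simple_graph_detach[OF simp_T leaf_edge_unique[OF assms(3,4)]] by (simp add: T')
  have fin: "finite ?A"
    by (rule finite_subtrees_le[OF simp_T'])
  have inj: "inj_on (attach u v) ?B"
  proof (rule inj_on_inverseI)
    fix S assume "S \<in> ?B"
    then have S: "S \<in> ?A"
      by blast
    have "u \<notin> verts S" "{u, v} \<notin> edges S"
      using A(2)[OF S] A(4)[OF S] assms(6) by blast+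
    then show "detach u v (attach u v S) = S"
      by (rule detach_attach)
  qed
  have decomp: "subtrees_le k T = insert ({u}, {}) (?A \<union> attach u v ` ?B)"
    using subtrees_le_pendant[OF simp_T assms(3,4)] by (simp add: T')
  have disj: "?A \<inter> attach u v ` ?B = {}"
  proof -
    have "u \<in> verts S" if "S \<in> attach u v ` ?B" for S
      using that by (elim imageE) simp
    then show ?thesis
      using A(2) by blast
  qed
  have single: "({u}, {}) \<notin> ?A \<union> attach u v ` ?B"
  proof -
    have "({u}, {}) \<noteq> attach u v S" for S
      by (simp add: attach_def)
    moreover have "({u}, {}) \<notin> ?A"
      using A(2)[of "({u}, {})"] by auto
    ultimately show ?thesis
      by blast
  qed
  have "subtree_gf k T' f' g' = (\<Sum>S\<in>?A. subtree_weight k f g S +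
    (if v \<in> verts S \<and> degree S v < k then subtree_weight k f g (attach u v S) else 0))"
    unfolding subtree_gf_def
  proof (rule sum.cong[OF refl])
    fix S assume S: "S \<in> ?A"
    show "subtree_weight k f' g' S = subtree_weight k f g S +
      (if v \<in> verts S \<and> degree S v < k then subtree_weight k f g (attach u v S) else 0)"
    proof (rule subtree_weight_pendant)
      show "simple_graph S" "u \<notin> verts S"
        by (fact A(1)[OF S] A(2)[OF S])+
      show "degree S v \<le> k" if "v \<in> verts S"
        by (rule A(5)[OF S that])
      show "g' e = g e" if "e \<in> edges S" for e
        using that A(4)[OF S] by (intro assms(7)) blast
      show "f' w i =
        (if w = v
         then component (f v) (int i) + component (f v) (int i - 1) * g {u, v} * (\<Sum>j<k. f u j)
         else f w i)" if "w \<in> verts S" "i \<le> k" for w i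
        using that A(3)[OF S] by (intro assms(8)) blast+
    qed
  qed
  also have "\<dots> = (\<Sum>S\<in>?A. subtree_weight k f g S) +
      (\<Sum>S\<in>?B. subtree_weight k f g (attach u v S))"
    using fin by (simp only: sum.distrib sum.inter_filter)
  also have "\<dots> = (\<Sum>S\<in>?A \<union> attach u v ` ?B. subtree_weight k f g S)"
    using sum.union_disjoint[OF fin _ disj, of "subtree_weight k f g"] fin
    by (simp add: sum.reindex[OF inj])
  finally have "subtree_gf k T' f' g' = \<dots>" .
  moreover have "subtree_gf k T f g = subtree_weight k f g ({u}, {}) +
      (\<Sum>S\<in>?A \<union> attach u v ` ?B. subtree_weight k f g S)"
    unfolding subtree_gf_def decomp using fin single by (intro sum.insert) simp_all
  ultimately show ?thesis
    by (simp only: subtree_weight_singleton add.commute)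
qed

end
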